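(* Let $k\ge 4$ be an integer. The body $\mathcal B_k$ contains the uniform law on $k$ points and every point mass.
   Context: For an integer $k\ge 2$ and $t\in[0,1]$ put $\psi_k(t):=\dfrac{1-t-(1-t)^k}{k-1}$. For a probability law $p$ on a set of $k$ points, let $p_1^{\downarrow}\ge p_2^{\downarrow}\ge\cdots\ge p_k^{\downarrow}$ be its atoms sorted in decreasing order (with multiplicity). The body $\mathcal B_k$ is the set of probability laws $p$ on $k$ points with $p_k^{\downarrow}\ge\psi_k(p_2^{\downarrow})$. *)

theory Defs
  imports "HOL-Probability.Probability_Mass_Function" "HOL-Library.Multiset"
begin

definition psi :: "nat \<Rightarrow> real \<Rightarrow> real" where
  "psi k t = (1 - t - (1 - t) ^ k) / (real k - 1)"

text \<open>
  A law on the finite set \<open>S\<close> of points is a \<open>pmf\<close> supported in \<open>S\<close>. Its atoms are the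
  \<open>card S\<close> values \<open>pmf p x\<close> for \<open>x \<in> S\<close>, counted with multiplicity and including zeros.
\<close>

definition atoms_desc :: "'a set \<Rightarrow> 'a pmf \<Rightarrow> real list" where
  "atoms_desc S p = rev (sorted_list_of_multiset (image_mset (pmf p) (mset_set S)))"

text \<open>The index \<open>j\<close> is 1-based: \<open>atom_desc S p 1\<close> is the largest atom and
  \<open>atom_desc S p (card S)\<close> the smallest; only \<open>1 \<le> j \<le> card S\<close> is meaningful.\<close>

definition atom_desc :: "'a set \<Rightarrow> 'a pmf \<Rightarrow> nat \<Rightarrow> real" where
  "atom_desc S p j = atoms_desc S p ! (j - 1)"

text \<open>The body \<open>\<B>\<^sub>k\<close>, with \<open>k = card S\<close>, over an arbitrary finite set \<open>S\<close> of at least two points.\<close>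

definition body :: "'a set \<Rightarrow> 'a pmf set" where
  "body S = {p. set_pmf p \<subseteq> S \<and>
     atom_desc S p (card S) \<ge> psi (card S) (atom_desc S p 2)}"

end

theory Submission
  imports Defs
begin

text \<open>
  Both laws have explicit decreasing lists of atoms. For a point mass the list is
  \<open>1, 0, \<dots>, 0\<close>, and since \<open>\<psi>\<^sub>k\<close> vanishes at \<open>0\<close> it satisfies the defining inequality with equality.
  For the uniform law all atoms are \<open>1/k\<close>. There
  \<open>(1 - 1/k)/(k - 1) = 1/k\<close>, so \<open>\<psi>\<^sub>k(1/k) = 1/k - (1 - 1/k)\<^sup>k/(k - 1)\<close>, which is at most \<open>1/k\<close>
  because the subtracted term is nonnegative.
\<close>

text \<open>
  Sorting has a unique result, so the decreasing list of atoms can be exhibited instead of computed.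
\<close>

lemma atoms_desc_eqI:
  assumes "mset xs = image_mset (pmf p) (mset_set S)" and "sorted (rev xs)"
  shows "atoms_desc S p = xs"
proof -
  have "image_mset (pmf p) (mset_set S) = mset (rev xs)"
    using assms(1) by simp
  then show ?thesis
    using assms(2) by (simp only: atoms_desc_def sorted_list_of_multiset_mset sorted_sort_id rev_rev_ident)
qed

lemma atoms_desc_pmf_of_set:
  assumes "finite S" and "S \<noteq> {}"
  shows "atoms_desc S (pmf_of_set S) = replicate (card S) (1 / real (card S))"
proof (rule atoms_desc_eqI)
  have "image_mset (pmf (pmf_of_set S)) (mset_set S)
      = image_mset (\<lambda>_. 1 / real (card S)) (mset_set S)"
    using assms by (intro image_mset_cong) simp
  then show "mset (replicate (card S) (1 / real (card S)))
      = image_mset (pmf (pmf_of_set S)) (mset_set S)"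
    by (simp add: image_mset_const_eq)
qed simp

lemma atoms_desc_return_pmf:
  assumes "finite S" and "x \<in> S"
  shows "atoms_desc S (return_pmf x) = 1 # replicate (card S - 1) 0"
proof (rule atoms_desc_eqI)
  have "image_mset (pmf (return_pmf x)) (mset_set (S - {x}))
      = image_mset (\<lambda>_. 0) (mset_set (S - {x}))"
    using assms by (intro image_mset_cong) (auto simp: indicator_def)
  moreover have "mset_set S = add_mset x (mset_set (S - {x}))"
    using assms by (rule mset_set.remove)
  ultimately show "mset (1 # replicate (card S - 1) 0)
      = image_mset (pmf (return_pmf x)) (mset_set S)"
    using assms by (simp add: image_mset_const_eq)
qed (simp add: sorted_append)

lemma psi_0: "psi k 0 = 0"
  by (simp add: psi_def)

lemma psi_inverse_le:
  assumes "k \<ge> 2"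
  shows "psi k (1 / real k) \<le> 1 / real k"
proof -
  have "psi k (1 / real k) \<le> (1 - 1 / real k) / (real k - 1)"
    unfolding psi_def using assms by (intro divide_right_mono) auto
  also have "\<dots> = 1 / real k"
    using assms by (simp add: field_simps)
  finally show ?thesis .
qed

theorem proposition2p1:
  fixes k :: nat and S :: "'a set"
  assumes "k \<ge> 4" and "finite S" and "card S = k"
  shows "pmf_of_set S \<in> body S \<and> (\<forall>x\<in>S. return_pmf x \<in> body S)"
proof (intro conjI ballI)
  have "S \<noteq> {}" using assms by auto
  then show "pmf_of_set S \<in> body S"
    using assms psi_inverse_le[of k]
    by (simp add: body_def atom_desc_def atoms_desc_pmf_of_set)
next
  fix x assume "x \<in> S"
  then show "return_pmf x \<in> body S"
    using assms
    by (simp add: body_def atom_desc_def atoms_desc_return_pmf nth_Cons' psi_0)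
qed

end
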